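(* Let $M$ be a matroid of rank $d$ on a finite ground set $E$, with set of bases $\mathscr{B}(M)$ and set of independent sets $\mathrm{I}_M$. Then the $f$-polynomial of the augmented Bergman complex $\Delta_M$ of $M$ is given by \[ f(\Delta_M,x)=|\mathscr{B}(M)|\,x^d+(x+1)\sum_{\substack{S\in \mathrm{I}_M\\ S\notin\mathscr{B}(M)}}x^{|S|}\,f(\underline{\Delta}_{M/S},x), \] where $M/S$ is the contraction of $M$ by $S$ and $\underline{\Delta}_{M/S}$ is the Bergman complex of $M/S$.
   Context: For a simplicial complex $\Delta$, its $f$-polynomial is $f(\Delta,x)=\sum_{F\in\Delta}x^{|F|}$ (sum over all faces, including the empty face). Bergman complex. For a matroid $N$ with lattice of flats $\mathcal{L}(N)$, having minimum $\widehat{0}$ (the set of loops) and maximum $\widehat{1}$ (the ground set), the Bergman complex $\underline{\Delta}_N$ is the simplicial complex of all chains (including the empty chain) in the poset $\mathcal{L}(N)\setminus\{\widehat{0},\widehat{1}\}$. In particular $\underline{\Delta}_N=\{\varnothing\}$ if $N$ has rank zero or one. Augmented Bergman complex. Let $M$ be a matroid on $E$ with lattice of flats $\mathcal{L}(M)$. Let $U=\{u_i : i\in E\}$ and $V_M=\{v_F : F\in\mathcal{L}(M)\setminus\{E\}\}$ be disjoint sets in one-to-one correspondence with $E$ and with the set of proper flats $\mathcal{L}(M)\setminus\{E\}$, respectively. The augmented Bergman complex $\Delta_M$ is the simplicial complex on $U\cup V_M$ whose faces are the sets $\{u_i: i\in S\}\cup\{v_{F_1},\dots,v_{F_k}\}$,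 where $S$ is an independent set of $M$, $F_1,\dots,F_k$ are proper flats, and either $k\ge1$ and $S\subseteq F_1\subset F_2\subset\cdots\subset F_k$ (strict inclusions between the $F_j$), or $k=0$ and $S$ is an arbitrary independent set. *)

theory Defs
  imports "HOL-Computational_Algebra.Polynomial"
begin

text \<open>A matroid is given by its finite ground set \<open>E\<close> and its family \<open>I\<close> of independent sets.\<close>

locale matroid =
  fixes E :: "'a set" and I :: "'a set set"
  assumes finite_ground: "finite E"
    and indep_subset_ground: "S \<in> I \<Longrightarrow> S \<subseteq> E"
    and empty_indep: "{} \<in> I"
    and indep_down_closed: "S \<in> I \<Longrightarrow> T \<subseteq> S \<Longrightarrow> T \<in> I"
    and indep_augment: "S \<in> I \<Longrightarrow> T \<in> I \<Longrightarrow> card S < card T \<Longrightarrow> \<exists>x \<in> T - S. insert x S \<in> I"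

definition bases_of :: "'a set set \<Rightarrow> 'a set \<Rightarrow> 'a set set" where
  "bases_of I A = {B. B \<in> I \<and> B \<subseteq> A \<and> (\<forall>T \<in> I. B \<subseteq> T \<and> T \<subseteq> A \<longrightarrow> T = B)}"

abbreviation bases :: "'a set \<Rightarrow> 'a set set \<Rightarrow> 'a set set" where
  "bases E I \<equiv> bases_of I E"

definition rank_of :: "'a set set \<Rightarrow> 'a set \<Rightarrow> nat" where
  "rank_of I A = Max (card ` {S \<in> I. S \<subseteq> A})"

definition flats :: "'a set \<Rightarrow> 'a set set \<Rightarrow> 'a set set" where
  "flats E I = {F. F \<subseteq> E \<and> (\<forall>x \<in> E - F. rank_of I F < rank_of I (insert x F))}"

definition loops :: "'a set \<Rightarrow> 'a set set \<Rightarrow> 'a set" where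
  "loops E I = {x \<in> E. {x} \<notin> I}"

text \<open>Independent sets of the contraction \<open>M/S\<close>, whose ground set is \<open>E - S\<close>: the sets that stay
  independent when joined to a basis of (the restriction to) \<open>S\<close>.\<close>

definition contract :: "'a set \<Rightarrow> 'a set set \<Rightarrow> 'a set \<Rightarrow> 'a set set" where
  "contract E I S = {A. A \<subseteq> E - S \<and> (\<exists>B \<in> bases_of I S. A \<union> B \<in> I)}"

text \<open>A simplicial complex is represented by the set of its faces. The sum is meaningful for
  finite complexes only.\<close>

definition f_polynomial :: "'v set set \<Rightarrow> int poly" where
  "f_polynomial \<Delta> = (\<Sum>F \<in> \<Delta>. monom 1 (card F))"

definition bergman_complex :: "'a set \<Rightarrow> 'a set set \<Rightarrow> 'a set set set" where
  "bergman_complex E I = {C. subset.chain (flats E I - {loops E I, E}) C}"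

text \<open>The vertices \<open>u\<^sub>i\<close> and \<open>v\<^sub>F\<close> are \<open>Inl i\<close> and \<open>Inr F\<close>. For a nonempty chain
  \<open>C = {F\<^sub>1 \<subset> \<dots> \<subset> F\<^sub>k}\<close> the smallest member \<open>F\<^sub>1\<close> is \<open>\<Inter>C\<close>.\<close>

definition augmented_bergman_complex :: "'a set \<Rightarrow> 'a set set \<Rightarrow> ('a + 'a set) set set" where
  "augmented_bergman_complex E I =
     {Inl ` S \<union> Inr ` C | S C. S \<in> I \<and> subset.chain (flats E I - {E}) C \<and> (C = {} \<or> S \<subseteq> \<Inter>C)}"

context matroid
begin

lemma finite_indep_sets: "finite I"
  using finite_subset[of I "Pow E"] finite_ground indep_subset_ground by auto

lemma finite_flats: "finite (flats E I)"
  using finite_subset[of "flats E I" "Pow E"] finite_ground by (auto simp: flats_def)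

lemma finite_bergman_complex: "finite (bergman_complex E I)"
  by (rule finite_subset[of _ "Pow (flats E I)"])
    (auto simp: bergman_complex_def subset_chain_def finite_flats)

lemma finite_augmented_bergman_complex: "finite (augmented_bergman_complex E I)"
proof (rule finite_subset)
  show "augmented_bergman_complex E I
      \<subseteq> (\<lambda>(S, C). Inl ` S \<union> Inr ` C) ` (I \<times> Pow (flats E I))"
    unfolding augmented_bergman_complex_def subset_chain_def by fast
qed (simp add: finite_indep_sets finite_flats)

lemma contract_indep:
  assumes "S \<in> I"
  shows "contract E I S = {A. A \<subseteq> E - S \<and> A \<union> S \<in> I}"
proof -
  have "bases_of I S = {S}"
    using assms by (auto simp: bases_of_def)
  then show ?thesis
    by (simp add: contract_def)
qed

lemma matroid_contract:
  assumes S: "S \<in> I"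
  shows "matroid (E - S) (contract E I S)"
proof
  fix A T assume A: "A \<in> contract E I S" and T: "T \<in> contract E I S" and "card A < card T"
  have fin: "finite S" "finite A" "finite T"
    using A T S finite_ground indep_subset_ground
    by (auto simp: contract_indep intro: finite_subset[OF _ finite_ground])
  have "card (A \<union> S) = card A + card S" "card (T \<union> S) = card T + card S"
    using A T fin S by (auto simp: contract_indep intro!: card_Un_disjoint)
  then obtain x where "x \<in> (T \<union> S) - (A \<union> S)" "insert x (A \<union> S) \<in> I"
    using indep_augment[of "A \<union> S" "T \<union> S"] A T S \<open>card A < card T\<close> by (auto simp: contract_indep)
  then show "\<exists>x \<in> T - A. insert x A \<in> contract E I S"
    using A T S by (auto simp: contract_indep)
next
  fix A T assume "A \<in> contract E I S" "T \<subseteq> A"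
  then show "T \<in> contract E I S"
    using S indep_down_closed[of "A \<union> S" "T \<union> S"] by (auto simp: contract_indep)
qed (use S finite_ground in \<open>auto simp: contract_indep\<close>)

end

end

theory Submission
  imports Defs
begin

text \<open>Group the faces of the augmented complex by their independent part \<open>S\<close>: what remains is a
  chain of proper flats of \<open>M\<close> containing \<open>S\<close>, that is, a chain of proper flats of \<open>M/S\<close>. If \<open>S\<close> is
  a basis, only the empty chain occurs. Otherwise the set of loops of \<open>M/S\<close> is the least proper flat
  of \<open>M/S\<close>; it may be freely added to or removed from any chain, which accounts for the factor
  \<open>x + 1\<close>.\<close>

section \<open>f-polynomials of complexes of chains\<close>

lemma f_polynomial_altdef: "f_polynomial \<Delta> = (\<Sum>F \<in> \<Delta>. [:0, 1:] ^ card F)"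
  by (simp add: f_polynomial_def monom_altdef)

lemma finite_chains: "finite P \<Longrightarrow> finite {C. subset.chain P C}"
  by (rule finite_subset[of _ "Pow P"]) (auto simp: subset_chain_def)

lemma f_polynomial_chains_empty: "f_polynomial {C. subset.chain {} C} = 1"
proof -
  have "{C. subset.chain ({} :: 'a set set) C} = {{}}"
    by (auto simp: subset_chain_def)
  then show ?thesis
    by (simp add: f_polynomial_altdef)
qed

text \<open>Taking images under an order isomorphism matches the chains of \<open>P\<close> with
  those of \<open>Q\<close>, and injectivity of \<open>f\<close> keeps their sizes. This transports
  chains of flats above \<open>S\<close> to chains of flats of the contraction.\<close>

lemma f_polynomial_chains_iso:
  assumes bij: "bij_betw f P Q"
    and mono: "\<And>X Y. X \<in> P \<Longrightarrow> Y \<in> P \<Longrightarrow> f X \<subseteq> f Y \<longleftrightarrow> X \<subseteq> Y"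
  shows "f_polynomial {C. subset.chain Q C} = f_polynomial {C. subset.chain P C}"
proof -
  have inj: "inj_on f P" and Q: "Q = f ` P"
    using bij by (auto simp: bij_betw_def)
  have chain_image: "subset.chain Q (f ` C) \<longleftrightarrow> subset.chain P C" if "C \<subseteq> P" for C
  proof -
    have "f X \<subseteq> f Y \<longleftrightarrow> X \<subseteq> Y" if "X \<in> C" "Y \<in> C" for X Y
      using that \<open>C \<subseteq> P\<close> by (intro mono) auto
    then show ?thesis
      using that by (simp add: subset_chain_def Q image_mono)
  qed
  have "{C. subset.chain Q C} = (`) f ` {C. subset.chain P C}"
  proof (intro set_eqI iffI)
    fix D assume "D \<in> {C. subset.chain Q C}"
    moreover from this obtain C where "C \<subseteq> P" "D = f ` C"
      by (auto simp: subset_chain_def Q subset_image_iff)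
    ultimately show "D \<in> (`) f ` {C. subset.chain P C}"
      using chain_image by auto
  next
    fix D assume "D \<in> (`) f ` {C. subset.chain P C}"
    then obtain C where "subset.chain P C" "C \<subseteq> P" "D = f ` C"
      by (auto simp: subset_chain_def)
    then show "D \<in> {C. subset.chain Q C}"
      using chain_image by simp
  qed
  moreover have "inj_on ((`) f) {C. subset.chain P C}"
    by (rule inj_on_subset[OF inj_on_image_Pow[OF inj]]) (auto simp: subset_chain_def)
  moreover have "card (f ` C) = card C" if "subset.chain P C" for C
    using that inj by (auto simp: subset_chain_def intro: card_image inj_on_subset)
  ultimately show ?thesis
    by (simp add: f_polynomial_altdef sum.reindex)
qed

text \<open>The element \<open>m\<close> is comparable to everything in \<open>P\<close>, so
  inserting it into a chain that avoids it gives a chain again. Chains with \<open>m\<close> thus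
  correspond to chains without it, with size one larger.\<close>

lemma f_polynomial_chains_least:
  assumes fin: "finite P" and m: "m \<in> P" and least: "\<And>X. X \<in> P \<Longrightarrow> m \<subseteq> X"
  shows "f_polynomial {C. subset.chain P C} =
    ([:0, 1:] + 1) * f_polynomial {C. subset.chain (P - {m}) C}"
proof -
  let ?D = "{C. subset.chain (P - {m}) C}"
  have "{C. subset.chain P C} = ?D \<union> insert m ` ?D"
  proof (intro set_eqI iffI)
    fix C assume C: "C \<in> {C. subset.chain P C}"
    then have "C - {m} \<in> ?D"
      by (auto simp: subset_chain_def)
    moreover have "C = C - {m} \<or> C = insert m (C - {m})"
      by auto
    ultimately show "C \<in> ?D \<union> insert m ` ?D"
      by (metis UnCI imageI)
  next
    fix C assume "C \<in> ?D \<union> insert m ` ?D"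
    then obtain D where "subset.chain (P - {m}) D" "C = D \<or> C = insert m D"
      by blast
    moreover from this have "subset.chain P D" "\<forall>X \<in> D. m \<subseteq> X"
      using least by (auto simp: subset_chain_def)
    ultimately show "C \<in> {C. subset.chain P C}"
      using m by (auto simp: subset_chain_insert)
  qed
  moreover have "?D \<inter> insert m ` ?D = {}"
    by (auto simp: subset_chain_def)
  moreover have "inj_on (insert m) ?D"
    by (intro inj_onI) (metis Diff_iff insert_ident mem_Collect_eq singletonI subsetD subset_chain_def)
  moreover have "finite ?D"
    using fin by (simp add: finite_chains)
  moreover have "card (insert m C) = Suc (card C)" if "C \<in> ?D" for C
    using that fin by (subst card_insert_disjoint) (auto simp: subset_chain_def intro: finite_subset)
  ultimately have "f_polynomial {C. subset.chain P C} =
      f_polynomial ?D + (\<Sum>C \<in> ?D. [:0, 1:] * [:0, 1:] ^ card C)"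
    by (simp add: f_polynomial_altdef sum.union_disjoint sum.reindex del: mult_pCons_left)
  then show ?thesis
    by (simp only: f_polynomial_altdef sum_distrib_left[symmetric] distrib_right mult_1_left
        add.commute)
qed

section \<open>Rank, bases and loops\<close>

context matroid
begin

lemma finite_indep: "S \<in> I \<Longrightarrow> finite S"
  using indep_subset_ground finite_ground finite_subset by blast

lemma card_le_rank: "S \<in> I \<Longrightarrow> S \<subseteq> A \<Longrightarrow> card S \<le> rank_of I A"
  unfolding rank_of_def using finite_indep_sets by (intro Max_ge) auto

lemma obtain_rank:
  obtains B where "B \<in> I" "B \<subseteq> A" "card B = rank_of I A"
proof -
  have "rank_of I A \<in> card ` {S \<in> I. S \<subseteq> A}"
    unfolding rank_of_def using finite_indep_sets empty_indep by (intro Max_in) auto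
  then show ?thesis
    using that by auto
qed

lemma rank_mono: "A \<subseteq> B \<Longrightarrow> rank_of I A \<le> rank_of I B"
  by (metis card_le_rank obtain_rank subset_trans)

text \<open>As long as \<open>S\<close> is too small, augmentation from a largest independent subset
  of \<open>A\<close> supplies a further element, and this element lies in \<open>A\<close>.\<close>

lemma extend_to_rank:
  assumes "S \<in> I" "S \<subseteq> A"
  obtains B where "B \<in> I" "S \<subseteq> B" "B \<subseteq> A" "card B = rank_of I A"
proof -
  have "\<exists>B. B \<in> I \<and> S \<subseteq> B \<and> B \<subseteq> A \<and> card B = rank_of I A"
    using assms
  \<comment> \<open>The measure is the number of elements still missing.\<close>
  proof (induction "rank_of I A - card S" arbitrary: S rule: less_induct)
    case less
    show ?case
    proof (cases "card S = rank_of I A")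
      case False
      then have lt: "card S < rank_of I A"
        using less.prems card_le_rank le_neq_implies_less by blast
      obtain T where T: "T \<in> I" "T \<subseteq> A" "card T = rank_of I A"
        by (rule obtain_rank)
      then obtain x where x: "x \<in> T - S" "insert x S \<in> I"
        using indep_augment less.prems lt by metis
      then have "card (insert x S) = Suc (card S)"
        using less.prems finite_indep by simp
      then have "\<exists>B. B \<in> I \<and> insert x S \<subseteq> B \<and> B \<subseteq> A \<and> card B = rank_of I A"
        using lt x T less.prems by (intro less.hyps) auto
      then show ?thesis
        by blast
    qed (use less.prems in blast)
  qed
  then show ?thesis
    using that by blast
qed

text \<open>\<open>bases_of\<close> asks for maximality under inclusion only. An extension of
  \<open>B\<close> to full rank must equal \<open>B\<close>, so its size is maximal too.\<close>

lemma basis_card: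
  assumes "B \<in> bases E I"
  shows "card B = rank_of I E"
proof -
  obtain T where "T \<in> I" "B \<subseteq> T" "T \<subseteq> E" "card T = rank_of I E"
    using assms extend_to_rank[of B E] unfolding bases_of_def by blast
  then show ?thesis
    using assms by (auto simp: bases_of_def)
qed

text \<open>A flat containing a basis already has full rank, so no further point could raise its
  rank. Hence only the empty chain can be joined to a basis.\<close>

lemma flat_above_basis:
  assumes "B \<in> bases E I" "F \<in> flats E I" "B \<subseteq> F"
  shows "F = E"
proof (rule ccontr)
  assume "F \<noteq> E"
  then obtain x where x: "x \<in> E - F" and "F \<subseteq> E"
    using assms(2) by (auto simp: flats_def)
  have "rank_of I E \<le> rank_of I F"
    using assms basis_card[of B] card_le_rank[of B F] by (auto simp: bases_of_def)
  moreover have "rank_of I (insert x F) \<le> rank_of I E"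
    using x \<open>F \<subseteq> E\<close> by (intro rank_mono) auto
  ultimately show False
    using assms(2) x by (auto simp: flats_def dest!: bspec[of _ _ x])
qed

lemma loops_subset_flat:
  assumes F: "F \<in> flats E I"
  shows "loops E I \<subseteq> F"
proof (rule subsetI, rule ccontr)
  fix x assume x: "x \<in> loops E I" and "x \<notin> F"
  then have "rank_of I F < rank_of I (insert x F)"
    using F by (auto simp: flats_def loops_def)
  \<comment> \<open>No independent set contains the loop \<open>x\<close>, so adding
    \<open>x\<close> to \<open>F\<close> leaves the rank unchanged.\<close>
  moreover have "{S \<in> I. S \<subseteq> insert x F} = {S \<in> I. S \<subseteq> F}"
    using x indep_down_closed[of _ "{x}"] by (auto simp: loops_def)
  ultimately show False
    by (simp add: rank_of_def)
qed

text \<open>The loops have rank zero, and any other point of \<open>E\<close> is independent on its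
  own and raises the rank to at least one.\<close>

lemma loops_flat: "loops E I \<in> flats E I"
proof -
  have "rank_of I (loops E I) = 0"
  proof -
    obtain B where B: "B \<in> I" "B \<subseteq> loops E I" "card B = rank_of I (loops E I)"
      by (rule obtain_rank)
    have "B = {}"
      using B indep_down_closed[OF \<open>B \<in> I\<close>, of "{_}"] by (auto simp: loops_def)
    with B show ?thesis
      by simp
  qed
  moreover have "0 < rank_of I (insert x (loops E I))" if "x \<in> E - loops E I" for x
    using that card_le_rank[of "{x}" "insert x (loops E I)"] by (auto simp: loops_def)
  ultimately show ?thesis
    by (auto simp: flats_def loops_def)
qed

section \<open>Flats of a contraction\<close>

lemma rank_contract:
  assumes S: "S \<in> I" and A: "A \<subseteq> E - S"
  shows "rank_of (contract E I S) A + card S = rank_of I (A \<union> S)"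
proof (rule antisym)
  interpret N: matroid "E - S" "contract E I S"
    using S by (rule matroid_contract)
  \<comment> \<open>For this inequality a largest independent set \<open>B\<close> of the
    contraction is enlarged by the disjoint set \<open>S\<close>.\<close>
  obtain B where B: "B \<in> contract E I S" "B \<subseteq> A" "card B = rank_of (contract E I S) A"
    by (rule N.obtain_rank)
  then have "card (B \<union> S) = card B + card S"
    using N.finite_indep[of B] finite_indep S A by (intro card_Un_disjoint) auto
  then show "rank_of (contract E I S) A + card S \<le> rank_of I (A \<union> S)"
    using B card_le_rank[of "B \<union> S" "A \<union> S"] S by (auto simp: contract_indep)
  \<comment> \<open>Conversely, a largest independent subset of \<open>A \<union> S\<close> can be
    chosen to contain \<open>S\<close>; removing \<open>S\<close> then costs exactly
    \<open>card S\<close> elements.\<close>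
  obtain T where T: "T \<in> I" "S \<subseteq> T" "T \<subseteq> A \<union> S" "card T = rank_of I (A \<union> S)"
    using S extend_to_rank[of S "A \<union> S"] by blast
  then have "T - S \<in> contract E I S" "T - S \<subseteq> A"
    using S A by (auto simp: contract_indep Un_absorb2)
  moreover have "card (T - S) + card S = card T"
    using T finite_indep card_Diff_subset[of S T] card_mono[of T S] S by auto
  ultimately show "rank_of I (A \<union> S) \<le> rank_of (contract E I S) A + card S"
    using N.card_le_rank[of "T - S" A] T by linarith
qed

text \<open>By \<open>rank_contract\<close> the two rank functions differ by the constant
  \<open>card S\<close>, so adding a point raises one exactly when it raises the other.\<close>

lemma flats_contract:
  assumes S: "S \<in> I" and G: "G \<subseteq> E - S"
  shows "G \<in> flats (E - S) (contract E I S) \<longleftrightarrow> G \<union> S \<in> flats E I"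
proof -
  have "rank_of (contract E I S) G < rank_of (contract E I S) (insert x G) \<longleftrightarrow>
      rank_of I (G \<union> S) < rank_of I (insert x (G \<union> S))" if "x \<in> E - S - G" for x
    using that rank_contract[OF S G] rank_contract[OF S, of "insert x G"] G by auto
  moreover have "E - S - G = E - (G \<union> S)"
    by auto
  ultimately show ?thesis
    using G S indep_subset_ground by (auto simp: flats_def)
qed

lemma bij_betw_flats_contract:
  assumes S: "S \<in> I"
  shows "bij_betw (\<lambda>F. F - S) {F \<in> flats E I - {E}. S \<subseteq> F}
    (flats (E - S) (contract E I S) - {E - S})"
proof (rule bij_betw_byWitness[where f' = "\<lambda>G. G \<union> S"])
  have "F - S \<in> flats (E - S) (contract E I S) - {E - S}"
    if "F \<in> flats E I" "F \<noteq> E" "S \<subseteq> F" for F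
  proof -
    have "F \<subseteq> E" "F - S \<union> S = F"
      using that by (auto simp: flats_def)
    then show ?thesis
      using flats_contract[OF S, of "F - S"] that by auto
  qed
  then show "(\<lambda>F. F - S) ` {F \<in> flats E I - {E}. S \<subseteq> F}
      \<subseteq> flats (E - S) (contract E I S) - {E - S}"
    by auto
  have "G \<union> S \<in> flats E I - {E}"
    if "G \<in> flats (E - S) (contract E I S)" "G \<noteq> E - S" for G
  proof -
    have "G \<subseteq> E - S"
      using that by (auto simp: flats_def)
    then show ?thesis
      using flats_contract[OF S, of G] that by auto
  qed
  then show "(\<lambda>G. G \<union> S) ` (flats (E - S) (contract E I S) - {E - S})
      \<subseteq> {F \<in> flats E I - {E}. S \<subseteq> F}"
    by auto
qed (auto simp: flats_def)

text \<open>A non-basis \<open>S\<close> has a strictly larger independent superset, and any new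
  element of it is a non-loop of the contraction. This makes the set of loops a proper flat.\<close>

lemma loops_contract_proper:
  assumes "S \<in> I" "S \<notin> bases E I"
  shows "loops (E - S) (contract E I S) \<noteq> E - S"
proof -
  obtain T where T: "T \<in> I" "S \<subseteq> T" "T \<noteq> S"
    using assms indep_subset_ground by (auto simp: bases_of_def)
  then obtain x where x: "x \<in> T - S"
    by auto
  then have "insert x S \<in> I"
    using T by (intro indep_down_closed[OF \<open>T \<in> I\<close>]) auto
  then have "x \<in> E - S" "x \<notin> loops (E - S) (contract E I S)"
    using x T assms indep_subset_ground by (auto simp: loops_def contract_indep)
  then show ?thesis
    by auto
qed

section \<open>Grouping faces by their independent part\<close>

lemma f_polynomial_flats_above:
  assumes S: "S \<in> I" and "S \<notin> bases E I"
  shows "f_polynomial {C. subset.chain {F \<in> flats E I - {E}. S \<subseteq> F} C} =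
    ([:0, 1:] + 1) * f_polynomial (bergman_complex (E - S) (contract E I S))"
proof -
  interpret N: matroid "E - S" "contract E I S"
    using S by (rule matroid_contract)
  let ?Q = "flats (E - S) (contract E I S) - {E - S}"
  let ?m = "loops (E - S) (contract E I S)"
  have "f_polynomial {C. subset.chain {F \<in> flats E I - {E}. S \<subseteq> F} C} =
      f_polynomial {C. subset.chain ?Q C}"
    by (rule f_polynomial_chains_iso[OF bij_betw_flats_contract[OF S], symmetric]) auto
  \<comment> \<open>The loops form the least proper flat; deleting it leaves the poset of the
    Bergman complex.\<close>
  also have "\<dots> = ([:0, 1:] + 1) * f_polynomial {C. subset.chain (?Q - {?m}) C}"
    using N.finite_flats N.loops_flat loops_contract_proper[OF assms] N.loops_subset_flat
    by (intro f_polynomial_chains_least) auto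
  also have "?Q - {?m} = flats (E - S) (contract E I S) - {?m, E - S}"
    by auto
  finally show ?thesis
    by (simp add: bergman_complex_def)
qed

lemma f_polynomial_augmented_bergman:
  "f_polynomial (augmented_bergman_complex E I) =
    (\<Sum>S \<in> I. [:0, 1:] ^ card S *
      f_polynomial {C. subset.chain {F \<in> flats E I - {E}. S \<subseteq> F} C})"
proof -
  let ?chains = "\<lambda>S. {C. subset.chain {F \<in> flats E I - {E}. S \<subseteq> F} C}"
  \<comment> \<open>The disjoint sum \<open>S <+> C\<close> is the face with vertices
    \<open>Inl\<close> and \<open>Inr\<close>; it determines \<open>S\<close> and \<open>C\<close>,
    and its size is the sum of theirs.\<close>
  let ?face = "\<lambda>(S, C). S <+> C"
  have fin: "finite (?chains S)" for S
    using finite_flats by (simp add: finite_chains)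
  \<comment> \<open>The condition on \<open>\<Inter>C\<close> says that every member of
    \<open>C\<close> contains \<open>S\<close>, which is vacuous for the empty chain.\<close>
  have "subset.chain {F \<in> flats E I - {E}. S \<subseteq> F} C \<longleftrightarrow>
      subset.chain (flats E I - {E}) C \<and> (C = {} \<or> S \<subseteq> \<Inter>C)" for S C
    by (auto simp: subset_chain_def)
  then have "augmented_bergman_complex E I = ?face ` Sigma I ?chains"
    by (auto simp: augmented_bergman_complex_def Plus_def image_iff)
  moreover have "inj_on ?face (Sigma I ?chains)"
    by (auto simp: inj_on_def Plus_def set_eq_iff)
  moreover have "card (S <+> C) = card S + card C" if "S \<in> I" "C \<in> ?chains S" for S C
    using that finite_indep finite_flats
    by (intro card_Plus) (auto simp: subset_chain_def intro: finite_subset)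
  ultimately have "f_polynomial (augmented_bergman_complex E I) =
      (\<Sum>(S, C) \<in> Sigma I ?chains. [:0, 1:] ^ (card S + card C))"
    by (auto simp: f_polynomial_altdef sum.reindex intro!: sum.cong)
  also have "\<dots> = (\<Sum>S \<in> I. \<Sum>C \<in> ?chains S. [:0, 1:] ^ (card S + card C))"
    using finite_indep_sets fin by (subst sum.Sigma) auto
  finally show ?thesis
    by (simp add: f_polynomial_altdef power_add sum_distrib_left)
qed

end

theorem proposition2p7:
  fixes E :: "'a set" and I :: "'a set set" and d :: nat
  assumes "matroid E I"
    and "rank_of I E = d"
  shows "f_polynomial (augmented_bergman_complex E I) =
    of_nat (card (bases E I)) * [:0, 1:] ^ d +
    ([:0, 1:] + 1) *
      (\<Sum>S \<in> {S \<in> I. S \<notin> bases E I}.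
         [:0, 1:] ^ card S * f_polynomial (bergman_complex (E - S) (contract E I S)))"
proof -
  interpret matroid E I
    by (rule assms)
  let ?f = "\<lambda>S. [:0, 1:] ^ card S *
    f_polynomial {C. subset.chain {F \<in> flats E I - {E}. S \<subseteq> F} C}"
  have I: "I = bases E I \<union> {S \<in> I. S \<notin> bases E I}" "finite (bases E I)"
    using finite_indep_sets by (auto simp: bases_of_def)
  have "?f B = [:0, 1:] ^ d" if "B \<in> bases E I" for B
  proof -
    have "{F \<in> flats E I - {E}. B \<subseteq> F} = {}"
      using that flat_above_basis by auto
    then show ?thesis
      using basis_card[OF that] assms(2) by (simp only: f_polynomial_chains_empty mult_1_right)
  qed
  then have bases: "sum ?f (bases E I) = of_nat (card (bases E I)) * [:0, 1:] ^ d"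
    by simp
  have "f_polynomial (augmented_bergman_complex E I) = sum ?f I"
    by (rule f_polynomial_augmented_bergman)
  also have "\<dots> = sum ?f (bases E I) + sum ?f {S \<in> I. S \<notin> bases E I}"
    using I finite_indep_sets by (subst I(1), subst sum.union_disjoint) auto
  \<comment> \<open>Every non-basis contributes the same factor \<open>[:0, 1:] + 1\<close>, which
    is brought to the front so that it can leave the sum.\<close>
  also have "sum ?f {S \<in> I. S \<notin> bases E I} =
      (\<Sum>S \<in> {S \<in> I. S \<notin> bases E I}. ([:0, 1:] + 1) *
         ([:0, 1:] ^ card S * f_polynomial (bergman_complex (E - S) (contract E I S))))"
    using f_polynomial_flats_above
    by (intro sum.cong refl) (simp del: mult_pCons_left add: mult.left_commute)
  finally show ?thesis
    by (simp only: bases sum_distrib_left)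
qed

end
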